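(* Given a PTA $\mathcal{M}= (L, A, X, AP, V, T, l_0)$ in normal form and an APTA $\mathcal{A}= (L',A,X,AP,V',T',l_0')$, let $\mathsf{R}(\mathcal{M})=(S,A_\mathsf{R},AP,V_\mathsf{R},T_\mathsf{R},s_0)$ and $\mathsf{R}(\mathcal{A})=(S',A_\mathsf{R},AP,V_\mathsf{R}',T_\mathsf{R}',s_0')$ be the respective region automata. Then $\mathcal{M} \models \mathcal{A}$ if and only if $\mathsf{R}(\mathcal{M}) \models \mathsf{R}(\mathcal{A})$.
   Context: A probabilistic timed automaton (PTA) $\mathcal{M}=(L,A,X,AP,V,T,l_0)$ has locations $L$, actions $A$, clocks $X$, valuation $V:L\to 2^{AP}$ and edges $l\xrightarrow{g,a}\mu$ with guard $g\in CC(X)$ and distribution $\mu$ over pairs (reset set $Y\subseteq X$, target location). An abstract probabilistic timed automaton (APTA) $\mathcal{A}=(L',A,X,AP,V',T',l_0')$ has $V':L'\to 2^{2^{AP}}$ and three-valued edges (must/may) labelled by guard, action and a probability constraint over $2^X\times L'$. The region automaton $\mathsf{R}(\cdot)$ uses region equivalence: states are pairs (location, region $\theta$), labels are $(\theta'',a,\zeta)$ with $\theta''\in\mathrm{Succ}(\theta)\cap g$ the region in which the edge fires and $\zeta$ the reset set for each target; for a PTA it yields a probabilistic automaton (PA), for an APTA an abstract probabilistic automaton (APA) with constraints lifted accordingly and modalities inherited. A PTA is in normal form iff it is isomorphic to the reachable part of $(\mathcal{T}\circ\mathsf{R})(\mathcal{M})$, where $\mathcal{T}$ maps a PA over region-labelled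 alphabet back to a PTA. $\mathcal{M}\models\mathcal{A}$ is APTA satisfaction (a relation between locations relating initial locations such that must-edges of $\mathcal{A}$ are realized by possibly several PTA edges covering the guard within reachable region successors with distributions corresponding to satisfying distributions, every PTA edge is allowed by some may/must edge with larger guard, and valuations are admissible); $\mathsf{R}(\mathcal{M})\models\mathsf{R}(\mathcal{A})$ is standard PA-to-APA satisfaction.
   Formalization: The reset map ζ is not compared as part of the action label (θ'',a,ζ); instead each target of a region transition carries its reset set, and satisfaction of R(M) by R(A) requires related targets to have equal reset sets, since with ζ compared literally the equivalence fails. *)

theory Defs
  imports "HOL-Probability.Probability_Mass_Function"
begin

section \<open>Clocks, guards and regions\<close>

text \<open>Clock valuations over a clock set \<open>X\<close> are extensional functions, so that two valuations
  agreeing on \<open>X\<close> are equal and a region is a genuine equivalence class.\<close>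

definition vals :: "'x set \<Rightarrow> ('x \<Rightarrow> real) set" where
  "vals X = X \<rightarrow>\<^sub>E {0..}"

definition zero_val :: "'x set \<Rightarrow> 'x \<Rightarrow> real" where
  "zero_val X = (\<lambda>x\<in>X. 0)"

definition delay :: "'x set \<Rightarrow> real \<Rightarrow> ('x \<Rightarrow> real) \<Rightarrow> ('x \<Rightarrow> real)" where
  "delay X t v = (\<lambda>x\<in>X. v x + t)"

definition reset :: "'x set \<Rightarrow> 'x set \<Rightarrow> ('x \<Rightarrow> real) \<Rightarrow> ('x \<Rightarrow> real)" where
  "reset X Y v = (\<lambda>x\<in>X. if x \<in> Y then 0 else v x)"

text \<open>Guards are identified with the sets of valuations they denote: Boolean combinations of
  comparisons of clocks, and of differences of clocks, with integer constants. Comparisons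
  of differences are needed for every region to be a guard. \<open>K\<close> bounds the constants.\<close>

type_synonym 'x guard = "('x \<Rightarrow> real) set"

inductive_set CC :: "nat \<Rightarrow> 'x set \<Rightarrow> 'x guard set" for K :: nat and X :: "'x set" where
  "vals X \<in> CC K X"
| "x \<in> X \<Longrightarrow> c \<le> K \<Longrightarrow> {v \<in> vals X. v x \<le> real c} \<in> CC K X"
| "x \<in> X \<Longrightarrow> c \<le> K \<Longrightarrow> {v \<in> vals X. v x < real c} \<in> CC K X"
| "x \<in> X \<Longrightarrow> y \<in> X \<Longrightarrow> \<bar>d\<bar> \<le> int K \<Longrightarrow> {v \<in> vals X. v x - v y \<le> real_of_int d} \<in> CC K X"
| "x \<in> X \<Longrightarrow> y \<in> X \<Longrightarrow> \<bar>d\<bar> \<le> int K \<Longrightarrow> {v \<in> vals X. v x - v y < real_of_int d} \<in> CC K X"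
| "g \<in> CC K X \<Longrightarrow> h \<in> CC K X \<Longrightarrow> g \<inter> h \<in> CC K X"
| "g \<in> CC K X \<Longrightarrow> vals X - g \<in> CC K X"

text \<open>Region equivalence in the form suited to difference constraints: clock values and clock
  differences are compared by integral part and integrality, up to the bound \<open>K\<close>. For clocks
  not exceeding \<open>K\<close> this fixes the order of the fractional parts.\<close>

definition same_upto :: "nat \<Rightarrow> real \<Rightarrow> real \<Rightarrow> bool" where
  "same_upto K r s \<longleftrightarrow>
     r > real K \<and> s > real K \<or> r < - real K \<and> s < - real K \<or>
     \<lfloor>r\<rfloor> = \<lfloor>s\<rfloor> \<and> (frac r = 0 \<longleftrightarrow> frac s = 0)"

definition region_equiv :: "nat \<Rightarrow> 'x set \<Rightarrow> ('x \<Rightarrow> real) \<Rightarrow> ('x \<Rightarrow> real) \<Rightarrow> bool" where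
  "region_equiv K X v w \<longleftrightarrow>
     (\<forall>x\<in>X. same_upto K (v x) (w x)) \<and>
     (\<forall>x\<in>X. \<forall>y\<in>X. same_upto K (v x - v y) (w x - w y))"

type_synonym 'x region = "('x \<Rightarrow> real) set"

definition region_of :: "nat \<Rightarrow> 'x set \<Rightarrow> ('x \<Rightarrow> real) \<Rightarrow> 'x region" where
  "region_of K X v = {w \<in> vals X. region_equiv K X v w}"

definition regions :: "nat \<Rightarrow> 'x set \<Rightarrow> 'x region set" where
  "regions K X = region_of K X ` vals X"

definition Succ :: "nat \<Rightarrow> 'x set \<Rightarrow> 'x region \<Rightarrow> 'x region set" where
  "Succ K X \<theta> = {\<theta>' \<in> regions K X. \<exists>v\<in>\<theta>. \<exists>t\<ge>0. delay X t v \<in> \<theta>'}"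

text \<open>The pointwise image of a region under a reset may be a proper subset of a region, hence
  the closure under region equivalence.\<close>

definition reset_region :: "nat \<Rightarrow> 'x set \<Rightarrow> 'x region \<Rightarrow> 'x set \<Rightarrow> 'x region" where
  "reset_region K X \<theta> Y = (\<Union>v\<in>\<theta>. region_of K X (reset X Y v))"


section \<open>Distributions and correspondence\<close>

text \<open>Correspondence of distributions along \<open>R\<close>. The correspondence function \<open>\<delta>\<close> assigns a
  distribution to every element of the support of \<open>\<mu>\<close>, and \<open>bind_pmf \<mu> \<delta>\<close> is the
  distribution with weights \<open>\<Sum>s. \<mu>(s) * \<delta>(s)(t)\<close>.\<close>

definition corresponds :: "('s \<times> 't) set \<Rightarrow> 's pmf \<Rightarrow> 't pmf \<Rightarrow> bool" where
  "corresponds R \<mu> \<mu>' \<longleftrightarrow>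
     (\<exists>\<delta>. (\<forall>s\<in>set_pmf \<mu>. \<forall>t\<in>set_pmf (\<delta> s). (s, t) \<in> R) \<and> bind_pmf \<mu> \<delta> = \<mu>')"

definition labelled :: "('s \<times> 't) set \<Rightarrow> (('z \<times> 's) \<times> ('z \<times> 't)) set" where
  "labelled R = {((z, s), (z, t)) | z s t. (s, t) \<in> R}"

datatype modality = Absent | May | Must


section \<open>Probabilistic automata and abstract probabilistic automata\<close>

text \<open>Every target of a transition carries a label of type \<open>'z\<close>; for \<open>'z = unit\<close> these are the
  usual notions. In region automata the label of a target is its reset set, i.e. a region
  label \<open>(\<theta>'', a, \<zeta>)\<close> is represented by the action \<open>(\<theta>'', a)\<close> and by attaching
  \<open>\<zeta>\<close> target by target. It cannot be a function of the target state alone: resetting a clock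
  that is already 0 leads to the same region as not resetting it. It cannot be compared
  as part of the action either, as it refers to the targets of one particular automaton.
  A probability constraint is the set of distributions satisfying it.\<close>

record ('s, 'b, 'z, 'p) pa =
  pa_states :: "'s set"
  pa_acts :: "'b set"
  pa_props :: "'p set"
  pa_val :: "'s \<Rightarrow> 'p set"
  pa_trans :: "('s \<times> 'b \<times> ('z \<times> 's) pmf) set"
  pa_init :: 's

record ('s, 'b, 'z, 'p) apa =
  apa_states :: "'s set"
  apa_acts :: "'b set"
  apa_props :: "'p set"
  apa_val :: "'s \<Rightarrow> 'p set set"
  apa_trans :: "'s \<Rightarrow> 'b \<Rightarrow> ('z \<times> 's) pmf set \<Rightarrow> modality"
  apa_init :: 's

definition pa_reach :: "('s, 'b, 'z, 'p) pa \<Rightarrow> 's set" where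
  "pa_reach P =
     {(s, s'). \<exists>b \<mu> z. (s, b, \<mu>) \<in> pa_trans P \<and> (z, s') \<in> set_pmf \<mu>}\<^sup>* `` {pa_init P}"

definition pa_sat_rel ::
    "('s, 'b, 'z, 'p) pa \<Rightarrow> ('t, 'b, 'z, 'p) apa \<Rightarrow> ('s \<times> 't) set \<Rightarrow> bool" where
  "pa_sat_rel P N R \<longleftrightarrow>
     R \<subseteq> pa_states P \<times> apa_states N \<and>
     (\<forall>(s, t)\<in>R.
        (\<forall>b \<phi>. apa_trans N t b \<phi> = Must \<longrightarrow>
           (\<exists>\<mu>. (s, b, \<mu>) \<in> pa_trans P \<and> (\<exists>\<mu>'\<in>\<phi>. corresponds (labelled R) \<mu> \<mu>'))) \<and>
        (\<forall>b \<mu>. (s, b, \<mu>) \<in> pa_trans P \<longrightarrow>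
           (\<exists>\<phi>. apa_trans N t b \<phi> \<noteq> Absent \<and> (\<exists>\<mu>'\<in>\<phi>. corresponds (labelled R) \<mu> \<mu>'))) \<and>
        pa_val P s \<in> apa_val N t)"

definition pa_sat :: "('s, 'b, 'z, 'p) pa \<Rightarrow> ('t, 'b, 'z, 'p) apa \<Rightarrow> bool" where
  "pa_sat P N \<longleftrightarrow> (\<exists>R. pa_sat_rel P N R \<and> (pa_init P, apa_init N) \<in> R)"


section \<open>Probabilistic timed automata and abstract probabilistic timed automata\<close>

record ('l, 'a, 'x, 'p) pta =
  pta_locs :: "'l set"
  pta_acts :: "'a set"
  pta_clocks :: "'x set"
  pta_props :: "'p set"
  pta_val :: "'l \<Rightarrow> 'p set"
  pta_edges :: "('l \<times> 'x guard \<times> 'a \<times> ('x set \<times> 'l) pmf) set"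
  pta_init :: 'l

record ('l, 'a, 'x, 'p) apta =
  apta_locs :: "'l set"
  apta_acts :: "'a set"
  apta_clocks :: "'x set"
  apta_props :: "'p set"
  apta_val :: "'l \<Rightarrow> 'p set set"
  apta_edges :: "'l \<Rightarrow> 'x guard \<Rightarrow> 'a \<Rightarrow> ('x set \<times> 'l) pmf set \<Rightarrow> modality"
  apta_init :: 'l

definition is_pta :: "nat \<Rightarrow> ('l, 'a, 'x, 'p) pta \<Rightarrow> bool" where
  "is_pta K M \<longleftrightarrow>
     finite (pta_locs M) \<and> finite (pta_acts M) \<and> finite (pta_clocks M) \<and> finite (pta_props M) \<and>
     pta_init M \<in> pta_locs M \<and>
     (\<forall>l\<in>pta_locs M. pta_val M l \<subseteq> pta_props M) \<and>
     (\<forall>(l, g, a, \<mu>)\<in>pta_edges M.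
        l \<in> pta_locs M \<and> g \<in> CC K (pta_clocks M) \<and> a \<in> pta_acts M \<and>
        set_pmf \<mu> \<subseteq> Pow (pta_clocks M) \<times> pta_locs M)"

definition is_apta :: "nat \<Rightarrow> ('l, 'a, 'x, 'p) apta \<Rightarrow> bool" where
  "is_apta K A \<longleftrightarrow>
     finite (apta_locs A) \<and> finite (apta_acts A) \<and> finite (apta_clocks A) \<and>
     finite (apta_props A) \<and>
     apta_init A \<in> apta_locs A \<and>
     (\<forall>l\<in>apta_locs A. apta_val A l \<subseteq> Pow (apta_props A)) \<and>
     (\<forall>l g a \<phi>. apta_edges A l g a \<phi> \<noteq> Absent \<longrightarrow>
        l \<in> apta_locs A \<and> g \<in> CC K (apta_clocks A) \<and> a \<in> apta_acts A \<and>
        (\<forall>\<mu>\<in>\<phi>. set_pmf \<mu> \<subseteq> Pow (apta_clocks A) \<times> apta_locs A))"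


section \<open>Region automata\<close>

text \<open>Firing an edge in region \<open>\<theta>''\<close> turns a target \<open>(Y, l)\<close> into the state
  \<open>(l, \<theta>''[Y := 0])\<close>, labelled with \<open>Y\<close>.\<close>

definition region_dist ::
    "nat \<Rightarrow> 'x set \<Rightarrow> 'x region \<Rightarrow> ('x set \<times> 'l) pmf \<Rightarrow> ('x set \<times> ('l \<times> 'x region)) pmf" where
  "region_dist K X \<theta>'' = map_pmf (\<lambda>(Y, l). (Y, (l, reset_region K X \<theta>'' Y)))"

definition region_pa ::
    "nat \<Rightarrow> ('l, 'a, 'x, 'p) pta \<Rightarrow> ('l \<times> 'x region, 'x region \<times> 'a, 'x set, 'p) pa" where
  "region_pa K M = (let X = pta_clocks M in
     \<lparr> pa_states = pta_locs M \<times> regions K X,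
       pa_acts = regions K X \<times> pta_acts M,
       pa_props = pta_props M,
       pa_val = (\<lambda>(l, \<theta>). pta_val M l),
       pa_trans = {((l, \<theta>), (\<theta>'', a), region_dist K X \<theta>'' \<mu>) | l \<theta> \<theta>'' a \<mu> g.
         (l, g, a, \<mu>) \<in> pta_edges M \<and> \<theta> \<in> regions K X \<and> \<theta>'' \<in> Succ K X \<theta> \<and> \<theta>'' \<subseteq> g},
       pa_init = (pta_init M, region_of K X (zero_val X)) \<rparr>)"

text \<open>A region transition arising both from a must-edge and from a may-edge is required.\<close>

definition region_apa ::
    "nat \<Rightarrow> ('l, 'a, 'x, 'p) apta \<Rightarrow> ('l \<times> 'x region, 'x region \<times> 'a, 'x set, 'p) apa" where
  "region_apa K A = (let X = apta_clocks A in
     \<lparr> apa_states = apta_locs A \<times> regions K X,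
       apa_acts = regions K X \<times> apta_acts A,
       apa_props = apta_props A,
       apa_val = (\<lambda>(l, \<theta>). apta_val A l),
       apa_trans = (\<lambda>(l, \<theta>) (\<theta>'', a) \<psi>.
         let induced = (\<lambda>m. \<theta> \<in> regions K X \<and> \<theta>'' \<in> Succ K X \<theta> \<and>
               (\<exists>g \<phi>. apta_edges A l g a \<phi> = m \<and> \<theta>'' \<subseteq> g \<and> \<psi> = region_dist K X \<theta>'' ` \<phi>))
         in if induced Must then Must else if induced May then May else Absent),
       apa_init = (apta_init A, region_of K X (zero_val X)) \<rparr>)"


section \<open>Normal form\<close>

definition pta_of_pa ::
    "'x set \<Rightarrow> ('s, 'x region \<times> 'a, 'x set, 'p) pa \<Rightarrow> ('s, 'a, 'x, 'p) pta" where
  "pta_of_pa X P =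
     \<lparr> pta_locs = pa_states P,
       pta_acts = snd ` pa_acts P,
       pta_clocks = X,
       pta_props = pa_props P,
       pta_val = pa_val P,
       pta_edges = {(s, \<theta>, a, \<mu>) | s \<theta> a \<mu>. (s, (\<theta>, a), \<mu>) \<in> pa_trans P},
       pta_init = pa_init P \<rparr>"

definition pta_reach :: "('l, 'a, 'x, 'p) pta \<Rightarrow> 'l set" where
  "pta_reach M =
     {(l, l'). \<exists>g a \<mu> Y. (l, g, a, \<mu>) \<in> pta_edges M \<and> (Y, l') \<in> set_pmf \<mu>}\<^sup>* `` {pta_init M}"

definition reachable_part :: "('l, 'a, 'x, 'p) pta \<Rightarrow> ('l, 'a, 'x, 'p) pta" where
  "reachable_part M =
     M \<lparr> pta_locs := pta_reach M,
         pta_edges := {e \<in> pta_edges M. fst e \<in> pta_reach M} \<rparr>"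

definition pta_iso :: "('l, 'a, 'x, 'p) pta \<Rightarrow> ('m, 'a, 'x, 'p) pta \<Rightarrow> bool" where
  "pta_iso M N \<longleftrightarrow>
     pta_acts M = pta_acts N \<and> pta_clocks M = pta_clocks N \<and> pta_props M = pta_props N \<and>
     (\<exists>f. bij_betw f (pta_locs M) (pta_locs N) \<and>
          f (pta_init M) = pta_init N \<and>
          (\<forall>l\<in>pta_locs M. pta_val N (f l) = pta_val M l) \<and>
          pta_edges N =
            (\<lambda>(l, g, a, \<mu>). (f l, g, a, map_pmf (map_prod id f) \<mu>)) ` pta_edges M)"

definition normal_form :: "nat \<Rightarrow> ('l, 'a, 'x, 'p) pta \<Rightarrow> bool" where
  "normal_form K M \<longleftrightarrow>
     pta_iso M (reachable_part (pta_of_pa (pta_clocks M) (region_pa K M)))"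


section \<open>Satisfaction between PTAs and APTAs\<close>

text \<open>The edges realizing a must-edge only have to cover those valuations of its guard that can
  be reached by delaying from a region in which the location is actually entered.\<close>

definition pta_sat_rel ::
    "nat \<Rightarrow> ('l, 'a, 'x, 'p) pta \<Rightarrow> ('m, 'a, 'x, 'p) apta \<Rightarrow> ('l \<times> 'm) set \<Rightarrow> bool" where
  "pta_sat_rel K M A R \<longleftrightarrow>
     R \<subseteq> pta_locs M \<times> apta_locs A \<and>
     (\<forall>(l, l')\<in>R.
        (\<forall>g' a \<phi>'. apta_edges A l' g' a \<phi>' = Must \<longrightarrow>
           (\<exists>E. finite E \<and> E \<subseteq> {(g, \<mu>). (l, g, a, \<mu>) \<in> pta_edges M} \<and>
              (\<forall>\<theta>. (l, \<theta>) \<in> pa_reach (region_pa K M) \<longrightarrow>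
                 g' \<inter> \<Union> (Succ K (pta_clocks M) \<theta>) \<subseteq> (\<Union>(g, \<mu>)\<in>E. g)) \<and>
              (\<forall>(g, \<mu>)\<in>E. \<exists>\<mu>'\<in>\<phi>'. corresponds (labelled R) \<mu> \<mu>'))) \<and>
        (\<forall>g a \<mu>. (l, g, a, \<mu>) \<in> pta_edges M \<longrightarrow>
           (\<exists>g' \<phi>'. apta_edges A l' g' a \<phi>' \<noteq> Absent \<and> g \<subseteq> g' \<and>
              (\<exists>\<mu>'\<in>\<phi>'. corresponds (labelled R) \<mu> \<mu>'))) \<and>
        pta_val M l \<in> apta_val A l')"

definition pta_sat :: "nat \<Rightarrow> ('l, 'a, 'x, 'p) pta \<Rightarrow> ('m, 'a, 'x, 'p) apta \<Rightarrow> bool" where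
  "pta_sat K M A \<longleftrightarrow> (\<exists>R. pta_sat_rel K M A R \<and> (pta_init M, apta_init A) \<in> R)"

end

theory Submission
  imports Defs
begin

text \<open>In a normal form every edge is guarded by a single region. Writing \<open>f\<close> for the isomorphism
  onto the reachable part of the region construction and \<open>\<rho> l\<close> for the region component of
  \<open>f l\<close>, an induction along paths shows that \<open>(l, \<rho> l)\<close> is reachable in the region
  automaton. These are already as many states as there are locations, hence all reachable
  states, so every location is entered in exactly one region. A satisfaction relation between
  locations then lifts to pairs \<open>((l, \<rho> l), (l', \<rho> l))\<close> and, conversely, is read off from such
  pairs; for must-edges one uses that there are finitely many regions and that each of them lies
  inside or outside of any given guard.\<close>

section \<open>Region equivalence\<close>

text \<open>The sum of floor and ceiling is even exactly at the integers, so it encodes both the integral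
  part and integrality; truncation accounts for the bound \<open>K\<close>.\<close>

definition region_code :: "nat \<Rightarrow> real \<Rightarrow> int" where
  "region_code K r = max (- (2 * int K + 1)) (min (2 * int K + 1) (\<lfloor>r\<rfloor> + \<lceil>r\<rceil>))"

lemma ceiling_eq_floor_or:
  fixes r :: real
  shows "\<lceil>r\<rceil> = \<lfloor>r\<rfloor> \<and> frac r = 0 \<or> \<lceil>r\<rceil> = \<lfloor>r\<rfloor> + 1 \<and> frac r \<noteq> 0"
  by (simp add: ceiling_altdef frac_def)

text \<open>Half of the sum is r itself at integers and the midpoint of the unit interval around r
  otherwise, so comparing r with the integer d amounts to comparing the sum with 2 * d.\<close>

lemma le_of_int_iff_floor_ceiling: "r \<le> of_int d \<longleftrightarrow> \<lfloor>r\<rfloor> + \<lceil>r\<rceil> \<le> 2 * d" for r :: real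
  unfolding ceiling_le_iff[symmetric] using ceiling_eq_floor_or[of r] by linarith

lemma less_of_int_iff_floor_ceiling: "r < of_int d \<longleftrightarrow> \<lfloor>r\<rfloor> + \<lceil>r\<rceil> < 2 * d" for r :: real
  unfolding floor_less_iff[symmetric] using ceiling_eq_floor_or[of r] by linarith

text \<open>Expresses \<open>same_upto\<close> as equality of values of a function. Reflexivity,
  symmetry and transitivity become immediate, and the finite range will bound the number of
  regions.\<close>

lemma same_upto_iff_region_code: "same_upto K r s \<longleftrightarrow> region_code K r = region_code K s"
proof -
  have K: "0 \<le> 2 * int K" by simp
  have gt: "real K < t \<longleftrightarrow> 2 * int K < \<lfloor>t\<rfloor> + \<lceil>t\<rceil>" for t
    using le_of_int_iff_floor_ceiling[of t "int K"] by (simp add: not_le[symmetric])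
  have lt: "t < - real K \<longleftrightarrow> \<lfloor>t\<rfloor> + \<lceil>t\<rceil> < - (2 * int K)" for t
    using less_of_int_iff_floor_ceiling[of t "- int K"] by simp
  have parity: "f = f' \<and> (p \<longleftrightarrow> q) \<longleftrightarrow> f + c = f' + c'"
    if "c = f \<and> p \<or> c = f + 1 \<and> \<not> p" "c' = f' \<and> q \<or> c' = f' + 1 \<and> \<not> q"
    for f c f' c' :: int and p q
    using that by (cases p; cases q; ((simp; fail) | (simp, presburger)))
  have "\<lfloor>r\<rfloor> = \<lfloor>s\<rfloor> \<and> (frac r = 0 \<longleftrightarrow> frac s = 0) \<longleftrightarrow> \<lfloor>r\<rfloor> + \<lceil>r\<rceil> = \<lfloor>s\<rfloor> + \<lceil>s\<rceil>"
    by (rule parity[OF ceiling_eq_floor_or ceiling_eq_floor_or])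
  \<comment> \<open>Truncation to [-(k+1), k+1] merges exactly the integers above k and those below
    -k; k \<ge> 0 keeps the two ends apart.\<close>
  moreover have trunc: "k < a \<and> k < b \<or> a < - k \<and> b < - k \<or> a = b \<longleftrightarrow>
      max (- (k + 1)) (min (k + 1) a) = max (- (k + 1)) (min (k + 1) b)"
    if "0 \<le> k" for a b k :: int
    using that by (auto simp: max_def min_def split: if_splits)
  ultimately show ?thesis
    unfolding same_upto_def region_code_def gt lt by (simp only: trunc[OF K])
qed

text \<open>Negation swaps floor and ceiling up to sign, and the truncation interval is symmetric.
  Needed for resets, which can turn a difference of clocks into a negated clock value.\<close>

lemma region_code_minus: "region_code K (- r) = - region_code K r"
  unfolding region_code_def by (simp add: floor_minus ceiling_minus)

text \<open>For such d the threshold 2 * d lies strictly inside the truncation interval, so the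
  codes still decide the comparison.\<close>

lemma same_upto_compare:
  assumes "same_upto K r s" "\<bar>d\<bar> \<le> int K"
  shows "r \<le> of_int d \<longleftrightarrow> s \<le> of_int d" "r < of_int d \<longleftrightarrow> s < of_int d"
  using assms
  unfolding same_upto_iff_region_code region_code_def le_of_int_iff_floor_ceiling
    less_of_int_iff_floor_ceiling
  by linarith+

section \<open>Regions as equivalence classes\<close>

lemma region_equiv_refl: "region_equiv K X v v"
  by (simp add: region_equiv_def same_upto_iff_region_code)

lemma region_equiv_sym: "region_equiv K X v w \<Longrightarrow> region_equiv K X w v"
  by (simp add: region_equiv_def same_upto_iff_region_code)

lemma region_equiv_trans:
  "region_equiv K X u v \<Longrightarrow> region_equiv K X v w \<Longrightarrow> region_equiv K X u w"
  by (simp add: region_equiv_def same_upto_iff_region_code)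

lemma region_of_eqI: "region_equiv K X v w \<Longrightarrow> region_of K X v = region_of K X w"
  unfolding region_of_def using region_equiv_sym region_equiv_trans by blast

lemma regions_eq_region_of:
  assumes "\<theta> \<in> regions K X" "v \<in> \<theta>"
  shows "\<theta> = region_of K X v"
  using assms region_of_eqI by (fastforce simp: regions_def region_of_def)

lemma regions_subset_vals: "\<theta> \<in> regions K X \<Longrightarrow> \<theta> \<subseteq> vals X"
  by (auto simp: regions_def region_of_def)

lemma regions_nonempty: "\<theta> \<in> regions K X \<Longrightarrow> \<theta> \<noteq> {}"
  using region_equiv_refl by (fastforce simp: regions_def region_of_def)

lemma regions_eqI:
  "\<theta> \<in> regions K X \<Longrightarrow> \<theta>' \<in> regions K X \<Longrightarrow> v \<in> \<theta> \<Longrightarrow> v \<in> \<theta>' \<Longrightarrow> \<theta> = \<theta>'"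
  using regions_eq_region_of by metis

text \<open>Regions are nonempty and pairwise disjoint. This later identifies a region with the
  guard containing it whenever that guard is itself a region.\<close>

lemma regions_subset_eq:
  "\<theta> \<in> regions K X \<Longrightarrow> \<theta>' \<in> regions K X \<Longrightarrow> \<theta> \<subseteq> \<theta>' \<Longrightarrow> \<theta> = \<theta>'"
  using regions_nonempty regions_eqI by (metis subsetD ex_in_conv)

section \<open>Finiteness of the set of regions\<close>

lemma region_code_range: "region_code K r \<in> {- (2 * int K + 1)..2 * int K + 1}"
  unfolding region_code_def by auto

text \<open>A region is determined by the codes of its clock values and clock differences, and over
  finitely many clocks only finitely many families of codes exist.\<close>

lemma finite_regions:
  assumes "finite X"
  shows "finite (regions K X)"
proof -
  define code where "code v = (\<lambda>x\<in>X. region_code K (v x),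
    \<lambda>p\<in>X \<times> X. region_code K (v (fst p) - v (snd p)))" for v :: "'a \<Rightarrow> real"
  define I where "I = {- (2 * int K + 1)..2 * int K + 1}"
  have "region_code K r \<in> I" for r unfolding I_def by (rule region_code_range)
  then have "code ` vals X \<subseteq> (X \<rightarrow>\<^sub>E I) \<times> (X \<times> X \<rightarrow>\<^sub>E I)"
    unfolding code_def by (intro image_subsetI SigmaI) (simp_all add: restrict_PiE_iff)
  moreover have "finite ((X \<rightarrow>\<^sub>E I) \<times> (X \<times> X \<rightarrow>\<^sub>E I))"
    using assms by (intro finite_cartesian_product finite_PiE) (auto simp: I_def)
  ultimately have fin: "finite (code ` vals X)" by (rule finite_subset)
  have eq: "region_of K X v = region_of K X w" if c: "code v = code w" for v w
  proof (rule region_of_eqI)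
    have "region_code K (v x) = region_code K (w x)" if "x \<in> X" for x
      using fun_cong[of _ _ x] that c by (fastforce simp: code_def restrict_def)
    moreover have "region_code K (v x - v y) = region_code K (w x - w y)"
      if "x \<in> X" "y \<in> X" for x y
      using fun_cong[of _ _ "(x, y)"] that c by (fastforce simp: code_def restrict_def)
    ultimately show "region_equiv K X v w"
      by (simp add: region_equiv_def same_upto_iff_region_code)
  qed
  \<comment> \<open>\<open>inv_into\<close> picks a representative valuation for each code, which
    exhibits the regions as an image of the finite set of codes.\<close>
  have "regions K X \<subseteq> (\<lambda>c. region_of K X (inv_into (vals X) code c)) ` code ` vals X"
  proof
    fix \<theta> assume "\<theta> \<in> regions K X"
    then obtain v where v: "v \<in> vals X" "\<theta> = region_of K X v" by (auto simp: regions_def)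
    then have "code (inv_into (vals X) code (code v)) = code v" by (simp add: f_inv_into_f)
    then have "\<theta> = region_of K X (inv_into (vals X) code (code v))" using eq v by metis
    then show "\<theta> \<in> (\<lambda>c. region_of K X (inv_into (vals X) code c)) ` code ` vals X"
      using v by blast
  qed
  then show ?thesis using fin finite_surj by blast
qed

section \<open>Guards and resets on regions\<close>

lemma CC_region_equiv:
  assumes "g \<in> CC K X" "v \<in> vals X" "w \<in> vals X" "region_equiv K X v w"
  shows "v \<in> g \<longleftrightarrow> w \<in> g"
  using assms
proof (induction rule: CC.induct)
  \<comment> \<open>In each atomic case the constant has absolute value at most K, where equivalent
    valuations still compare alike.\<close>
  case (2 x c)
  then show ?case using same_upto_compare(1)[of K "v x" "w x" "int c"]
    by (simp add: region_equiv_def)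
next
  case (3 x c)
  then show ?case using same_upto_compare(2)[of K "v x" "w x" "int c"]
    by (simp add: region_equiv_def)
next
  case (4 x y d)
  then show ?case using same_upto_compare(1)[of K "v x - v y" "w x - w y" d]
    by (simp add: region_equiv_def)
next
  case (5 x y d)
  then show ?case using same_upto_compare(2)[of K "v x - v y" "w x - w y" d]
    by (simp add: region_equiv_def)
qed auto

text \<open>Guards are unions of regions, so a must-edge can be realized region by region.\<close>

lemma region_subset_guard:
  assumes "g \<in> CC K X" "\<theta> \<in> regions K X" "v \<in> \<theta>" "v \<in> g"
  shows "\<theta> \<subseteq> g"
proof
  fix w assume "w \<in> \<theta>"
  moreover have "\<theta> = region_of K X v" using assms regions_eq_region_of by blast
  ultimately have "w \<in> vals X" "region_equiv K X v w" by (auto simp: region_of_def)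
  then show "w \<in> g" using assms CC_region_equiv regions_subset_vals by blast
qed

text \<open>After a reset every clock value and every difference is 0, an old value or difference,
  or the negative of an old value.\<close>

lemma region_equiv_reset:
  "region_equiv K X v w \<Longrightarrow> region_equiv K X (reset X Y v) (reset X Y w)"
  by (auto simp: region_equiv_def reset_def same_upto_iff_region_code region_code_minus)

text \<open>All valuations of \<theta> are reset into one and the same region, so the union defining
  \<open>reset_region\<close> is a single class.\<close>

lemma reset_region_in_regions:
  assumes "\<theta> \<in> regions K X"
  shows "reset_region K X \<theta> Y \<in> regions K X"
proof -
  obtain v where v: "v \<in> \<theta>" using assms regions_nonempty by blast
  then have \<theta>: "\<theta> = region_of K X v" using assms regions_eq_region_of by blast
  define \<theta>' where "\<theta>' = region_of K X (reset X Y v)"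
  have "region_of K X (reset X Y w) = \<theta>'" if "w \<in> \<theta>" for w
  proof -
    have "region_equiv K X v w" using that by (simp add: \<theta> region_of_def)
    then show ?thesis unfolding \<theta>'_def by (intro region_of_eqI[symmetric] region_equiv_reset)
  qed
  then have "reset_region K X \<theta> Y = \<theta>'"
    using v by (auto simp: reset_region_def)
  moreover have "reset X Y v \<in> vals X"
    using regions_subset_vals[OF assms] v by (auto simp: reset_def vals_def PiE_def Pi_def)
  ultimately show ?thesis by (simp add: regions_def \<theta>'_def)
qed

lemma region_of_zero_in_regions: "region_of K X (zero_val X) \<in> regions K X"
  by (auto simp: regions_def zero_val_def vals_def)

lemma Succ_subset_regions: "Succ K X \<theta> \<subseteq> regions K X"
  by (auto simp: Succ_def)


section \<open>Transitions of region automata\<close>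

lemma region_pa_trans_iff:
  "((l, \<theta>), (\<theta>'', a), \<nu>) \<in> pa_trans (region_pa K M) \<longleftrightarrow>
     (\<exists>g \<mu>. (l, g, a, \<mu>) \<in> pta_edges M \<and> \<theta> \<in> regions K (pta_clocks M) \<and>
        \<theta>'' \<in> Succ K (pta_clocks M) \<theta> \<and> \<theta>'' \<subseteq> g \<and> \<nu> = region_dist K (pta_clocks M) \<theta>'' \<mu>)"
  by (auto simp: region_pa_def Let_def)

lemma region_apa_trans_Must_iff:
  "apa_trans (region_apa K A) (l, \<theta>) (\<theta>'', a) \<psi> = Must \<longleftrightarrow>
     \<theta> \<in> regions K (apta_clocks A) \<and> \<theta>'' \<in> Succ K (apta_clocks A) \<theta> \<and>
     (\<exists>g \<phi>. apta_edges A l g a \<phi> = Must \<and> \<theta>'' \<subseteq> g \<and>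
        \<psi> = region_dist K (apta_clocks A) \<theta>'' ` \<phi>)"
  by (auto simp: region_apa_def Let_def)

lemma region_apa_trans_not_Absent_iff:
  "apa_trans (region_apa K A) (l, \<theta>) (\<theta>'', a) \<psi> \<noteq> Absent \<longleftrightarrow>
     \<theta> \<in> regions K (apta_clocks A) \<and> \<theta>'' \<in> Succ K (apta_clocks A) \<theta> \<and>
     (\<exists>g \<phi>. apta_edges A l g a \<phi> \<noteq> Absent \<and> \<theta>'' \<subseteq> g \<and>
        \<psi> = region_dist K (apta_clocks A) \<theta>'' ` \<phi>)"
proof -
  have "m \<noteq> Absent \<longleftrightarrow> m = Must \<or> m = May" for m by (cases m) auto
  then show ?thesis by (simp add: region_apa_def Let_def) blast
qed

section \<open>Region distributions and correspondence\<close>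

lemma set_pmf_region_dist:
  "(Y, l, \<theta>) \<in> set_pmf (region_dist K X \<theta>'' \<mu>) \<longleftrightarrow>
     (Y, l) \<in> set_pmf \<mu> \<and> \<theta> = reset_region K X \<theta>'' Y"
  by (force simp: region_dist_def)

lemma labelled_iff: "((z, s), (z', t)) \<in> labelled R \<longleftrightarrow> z = z' \<and> (s, t) \<in> R"
  by (auto simp: labelled_def)

text \<open>The region attached to a target depends only on its reset set, and
  \<open>labelled\<close> forces corresponding targets to have equal reset sets, hence equal
  regions.\<close>

lemma corresponds_region_dist:
  fixes \<mu> :: "('x set \<times> 'l) pmf" and \<mu>' :: "('x set \<times> 'm) pmf"
  assumes "corresponds (labelled R) \<mu> \<mu>'"
    and R': "\<And>Y l l'. (Y, l) \<in> set_pmf \<mu> \<Longrightarrow> (l, l') \<in> R \<Longrightarrow>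
      ((l, reset_region K X \<theta> Y), (l', reset_region K X \<theta> Y)) \<in> R'"
  shows "corresponds (labelled R') (region_dist K X \<theta> \<mu>) (region_dist K X \<theta> \<mu>')"
proof -
  obtain \<delta> where \<delta>: "\<And>s t. s \<in> set_pmf \<mu> \<Longrightarrow> t \<in> set_pmf (\<delta> s) \<Longrightarrow> (s, t) \<in> labelled R"
    and bind: "bind_pmf \<mu> \<delta> = \<mu>'"
    using assms(1) unfolding corresponds_def by blast
  \<comment> \<open>The region component of the argument is ignored; on the support it is a function
    of Y.\<close>
  define \<delta>' where "\<delta>' = (\<lambda>(Y, l, \<theta>' :: 'x region). region_dist K X \<theta> (\<delta> (Y, l)))"
  have "bind_pmf (region_dist K X \<theta> \<mu>) \<delta>' = bind_pmf \<mu> (\<lambda>s. region_dist K X \<theta> (\<delta> s))"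
    unfolding region_dist_def bind_map_pmf
    by (intro bind_pmf_cong) (auto simp: \<delta>'_def region_dist_def)
  also have "\<dots> = region_dist K X \<theta> \<mu>'"
    by (simp add: region_dist_def map_bind_pmf flip: bind)
  finally have "bind_pmf (region_dist K X \<theta> \<mu>) \<delta>' = region_dist K X \<theta> \<mu>'" .
  moreover have "(s, t) \<in> labelled R'"
    if st: "s \<in> set_pmf (region_dist K X \<theta> \<mu>)" "t \<in> set_pmf (\<delta>' s)" for s t
  proof -
    obtain Y l \<theta>1 Y' l' \<theta>2 where eq: "s = (Y, l, \<theta>1)" "t = (Y', l', \<theta>2)"
      by (cases s, cases t) auto
    then show ?thesis using st \<delta>[of "(Y, l)" "(Y', l')"] R'
      by (auto simp: \<delta>'_def set_pmf_region_dist labelled_iff)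
  qed
  ultimately show ?thesis unfolding corresponds_def by blast
qed

text \<open>Regions are restored on the source side, where Y determines them, and forgotten on the
  target side. Even if R' relates states with different regions, only pairs with a common region
  matter here.\<close>

lemma corresponds_region_distD:
  fixes \<mu> :: "('x set \<times> 'l) pmf" and \<mu>' :: "('x set \<times> 'm) pmf"
  assumes "corresponds (labelled R') (region_dist K X \<theta> \<mu>) (region_dist K X \<theta> \<mu>')"
    and R: "\<And>Y l l'. (Y, l) \<in> set_pmf \<mu> \<Longrightarrow>
      ((l, reset_region K X \<theta> Y), (l', reset_region K X \<theta> Y)) \<in> R' \<Longrightarrow> (l, l') \<in> R"
  shows "corresponds (labelled R) \<mu> \<mu>'"
proof -
  obtain \<delta>' where \<delta>': "\<And>s t. s \<in> set_pmf (region_dist K X \<theta> \<mu>) \<Longrightarrow> t \<in> set_pmf (\<delta>' s) \<Longrightarrow>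
      (s, t) \<in> labelled R'"
    and bind: "bind_pmf (region_dist K X \<theta> \<mu>) \<delta>' = region_dist K X \<theta> \<mu>'"
    using assms(1) unfolding corresponds_def by blast
  define forget where "forget = (\<lambda>(Y :: 'x set, l :: 'm, \<theta>' :: 'x region). (Y, l))"
  define \<delta> where "\<delta> = (\<lambda>(Y, l). map_pmf forget (\<delta>' (Y, l, reset_region K X \<theta> Y)))"
  have "bind_pmf \<mu> \<delta> = map_pmf forget (bind_pmf (region_dist K X \<theta> \<mu>) \<delta>')"
    unfolding region_dist_def bind_map_pmf map_bind_pmf
    by (intro bind_pmf_cong) (auto simp: \<delta>_def)
  also have "\<dots> = map_pmf forget (region_dist K X \<theta> \<mu>')" by (simp only: bind)
  also have "\<dots> = map_pmf (\<lambda>s. s) \<mu>'"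
    unfolding region_dist_def map_pmf_comp
    by (intro map_pmf_cong) (auto simp: forget_def)
  finally have "bind_pmf \<mu> \<delta> = \<mu>'" by simp
  moreover have "(s, t) \<in> labelled R"
    if st: "s \<in> set_pmf \<mu>" "t \<in> set_pmf (\<delta> s)" for s t
  proof -
    obtain Y l Y' l' where eq: "s = (Y, l)" "t = (Y', l')"
      by (cases s, cases t) auto
    have s: "(Y, l, reset_region K X \<theta> Y) \<in> set_pmf (region_dist K X \<theta> \<mu>)"
      using st eq by (simp add: set_pmf_region_dist)
    obtain \<theta>' where \<theta>': "(Y', l', \<theta>') \<in> set_pmf (\<delta>' (Y, l, reset_region K X \<theta> Y))"
      using st eq by (auto simp: \<delta>_def forget_def)
    \<comment> \<open>By \<open>bind\<close>, every value of \<delta>' on the support is a target of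
      the region distribution of \<mu>', which fixes its region.\<close>
    have "(Y', l', \<theta>') \<in> set_pmf (region_dist K X \<theta> \<mu>')"
      using s \<theta>' by (simp flip: bind) blast
    then have "\<theta>' = reset_region K X \<theta> Y'" by (simp add: set_pmf_region_dist)
    then show ?thesis using \<delta>'[OF s \<theta>'] R st eq by (auto simp: labelled_iff)
  qed
  ultimately show ?thesis unfolding corresponds_def by blast
qed


section \<open>Normal forms\<close>

lemma pta_reach_pta_of_pa: "pta_reach (pta_of_pa X P) = pa_reach P"
proof -
  have "{(s, s'). \<exists>g a \<mu> Y. (s, g, a, \<mu>) \<in> pta_edges (pta_of_pa X P) \<and> (Y, s') \<in> set_pmf \<mu>} =
    {(s, s'). \<exists>b \<mu> z. (s, b, \<mu>) \<in> pa_trans P \<and> (z, s') \<in> set_pmf \<mu>}"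
    by (auto simp: pta_of_pa_def)
  moreover have "pta_init (pta_of_pa X P) = pa_init P" by (simp add: pta_of_pa_def)
  ultimately show ?thesis unfolding pta_reach_def pa_reach_def by (simp only:)
qed

lemma pa_reach_init: "pa_init P \<in> pa_reach P"
  by (auto simp: pa_reach_def)

lemma pa_reach_step:
  "s \<in> pa_reach P \<Longrightarrow> (s, b, \<mu>) \<in> pa_trans P \<Longrightarrow> (z, s') \<in> set_pmf \<mu> \<Longrightarrow> s' \<in> pa_reach P"
  unfolding pa_reach_def Image_singleton_iff by (erule rtrancl_into_rtrancl) blast

lemma pa_reach_induct [consumes 1, case_names init step]:
  assumes "s \<in> pa_reach P" "Q (pa_init P)"
    and "\<And>s b \<mu> z s'. s \<in> pa_reach P \<Longrightarrow> Q s \<Longrightarrow> (s, b, \<mu>) \<in> pa_trans P \<Longrightarrow>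
      (z, s') \<in> set_pmf \<mu> \<Longrightarrow> Q s'"
  shows "Q s"
proof -
  have "(pa_init P, s) \<in> {(s, s'). \<exists>b \<mu> z. (s, b, \<mu>) \<in> pa_trans P \<and> (z, s') \<in> set_pmf \<mu>}\<^sup>*"
    using assms(1) by (simp add: pa_reach_def)
  then show ?thesis
  proof (induction rule: rtrancl_induct)
    case (step s s')
    then show ?case using assms(3)[of s] by (auto simp: pa_reach_def)
  qed (rule assms(2))
qed

lemma pa_init_region_pa:
  "pa_init (region_pa K M) = (pta_init M, region_of K (pta_clocks M) (zero_val (pta_clocks M)))"
  by (simp add: region_pa_def Let_def)

text \<open>All that both directions need from a normal form: the isomorphism has disappeared, and
  \<rho> gives the single region in which a location is entered.\<close>

locale entry_regions =
  fixes K :: nat and M :: "('l, 'a, 'x, 'p) pta" and X :: "'x set" and \<rho> :: "'l \<Rightarrow> 'x region"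
  assumes clocks: "X = pta_clocks M"
    and init: "\<rho> (pta_init M) = region_of K X (zero_val X)"
    and reg: "\<And>l. l \<in> pta_locs M \<Longrightarrow> \<rho> l \<in> regions K X"
    and reach: "\<And>l. l \<in> pta_locs M \<Longrightarrow> (l, \<rho> l) \<in> pa_reach (region_pa K M)"
    and unique: "\<And>l \<theta>. (l, \<theta>) \<in> pa_reach (region_pa K M) \<Longrightarrow> \<theta> = \<rho> l"
    and guard: "\<And>l g a \<mu>. (l, g, a, \<mu>) \<in> pta_edges M \<Longrightarrow> g \<in> Succ K X (\<rho> l)"
    and target: "\<And>l g a \<mu> Y l'. (l, g, a, \<mu>) \<in> pta_edges M \<Longrightarrow> (Y, l') \<in> set_pmf \<mu> \<Longrightarrow>
       \<rho> l' = reset_region K X g Y"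

text \<open>The isomorphism \<open>f\<close> may permute locations, so \<open>f l\<close> need not
  have first component l. Its region component nevertheless evolves along the edges of M itself,
  which is why (l, \<rho> l) is reachable too.\<close>

lemma normal_form_entry_regions:
  assumes pta: "is_pta K M" and nf: "normal_form K M" and X: "X = pta_clocks M"
  obtains \<rho> where "entry_regions K M X \<rho>"
proof -
  let ?P = "region_pa K M"
  let ?S = "pa_reach ?P"
  let ?N = "reachable_part (pta_of_pa X ?P)"
  have locs: "pta_locs ?N = ?S" by (simp add: reachable_part_def pta_reach_pta_of_pa)
  have init: "pta_init ?N = pa_init ?P" by (simp add: reachable_part_def pta_of_pa_def)
  have edges: "(s, g, a, \<nu>) \<in> pta_edges ?N \<longleftrightarrow> s \<in> ?S \<and> (s, (g, a), \<nu>) \<in> pa_trans ?P"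
    for s g a \<nu>
    by (cases s) (auto simp: reachable_part_def pta_reach_pta_of_pa, auto simp: pta_of_pa_def)
  obtain f where f: "bij_betw f (pta_locs M) ?S" and f0: "f (pta_init M) = pa_init ?P"
    and fE: "pta_edges ?N =
      (\<lambda>(l, g, a, \<mu>). (f l, g, a, map_pmf (map_prod id f) \<mu>)) ` pta_edges M"
    using nf unfolding normal_form_def pta_iso_def X[symmetric] locs init
    by (elim exE conjE) (rule that)
  define \<rho> where "\<rho> l = snd (f l)" for l
  have M: "l \<in> pta_locs M" "set_pmf \<mu> \<subseteq> Pow X \<times> pta_locs M"
    if "(l, g, a, \<mu>) \<in> pta_edges M" for l g a \<mu>
    using pta X by (auto simp: is_pta_def dest!: bspec[OF _ that])
  have init_loc: "pta_init M \<in> pta_locs M" and fin: "finite (pta_locs M)"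
    using pta by (auto simp: is_pta_def)
  have \<rho>0: "\<rho> (pta_init M) = region_of K X (zero_val X)"
    by (simp add: \<rho>_def f0 pa_init_region_pa X)
  have edge: "g \<in> Succ K X (\<rho> l) \<and> (\<forall>(Y, l')\<in>set_pmf \<mu>. \<rho> l' = reset_region K X g Y)"
    if e: "(l, g, a, \<mu>) \<in> pta_edges M" for l g a \<mu>
  proof -
    have "(f l, g, a, map_pmf (map_prod id f) \<mu>) \<in> pta_edges ?N"
      unfolding fE using e by force
    then have "((fst (f l), \<rho> l), (g, a), map_pmf (map_prod id f) \<mu>) \<in> pa_trans ?P"
      by (simp add: edges \<rho>_def)
    \<comment> \<open>\<mu>1 comes from an edge leaving \<open>fst (f l)\<close>, possibly another
      location than l. Only its shape as a region distribution is used: it yields the regions of the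
      targets.\<close>
    then obtain \<mu>1 where g: "g \<in> Succ K X (\<rho> l)"
      and \<mu>1: "map_pmf (map_prod id f) \<mu> = region_dist K X g \<mu>1"
      unfolding region_pa_trans_iff X[symmetric] by blast
    have "\<rho> l' = reset_region K X g Y" if "(Y, l') \<in> set_pmf \<mu>" for Y l'
    proof -
      have "(Y, f l') \<in> set_pmf (map_pmf (map_prod id f) \<mu>)" using that by force
      then have "(Y, fst (f l'), \<rho> l') \<in> set_pmf (region_dist K X g \<mu>1)"
        by (simp add: \<mu>1 \<rho>_def)
      then show ?thesis by (simp add: set_pmf_region_dist)
    qed
    then show ?thesis using g by blast
  qed
  have reach: "\<rho> l \<in> regions K X \<and> (l, \<rho> l) \<in> ?S"
    if "f l \<in> ?S" "l \<in> pta_locs M" for l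
    using that
  \<comment> \<open>The induction follows a path to \<open>f l\<close> in the reachable part; each
    of its steps is pulled back to an edge of M.\<close>
  proof (induction "f l" arbitrary: l rule: pa_reach_induct)
    case init
    then have "l = pta_init M"
      using f f0 init_loc by (metis bij_betw_imp_inj_on inj_onD)
    then show ?case
      using \<rho>0 pa_reach_init[of ?P] by (simp add: pa_init_region_pa region_of_zero_in_regions X)
  next
    case (step s b \<nu> Y l')
    obtain g a where b: "b = (g, a)" by (cases b)
    have "(s, g, a, \<nu>) \<in> pta_edges ?N" using step b by (simp add: edges)
    then obtain l \<mu> where e: "(l, g, a, \<mu>) \<in> pta_edges M" and s: "s = f l"
      and \<nu>: "\<nu> = map_pmf (map_prod id f) \<mu>"
      unfolding fE by auto
    have IH: "\<rho> l \<in> regions K X" "(l, \<rho> l) \<in> ?S" using step(2) s M(1)[OF e] by auto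
    obtain l2 where l2: "(Y, l2) \<in> set_pmf \<mu>" "f l2 = f l'" using step \<nu> by auto
    \<comment> \<open>Injectivity of \<open>f\<close> on locations identifies the target of the
      pulled-back edge.\<close>
    then have "l2 = l'"
      using f M(2)[OF e] step by (metis bij_betw_imp_inj_on inj_onD mem_Sigma_iff subsetD)
    then have l': "(Y, l') \<in> set_pmf \<mu>" using l2 by simp
    then have \<rho>: "\<rho> l' = reset_region K X g Y" and g: "g \<in> Succ K X (\<rho> l)"
      using edge[OF e] by auto
    \<comment> \<open>The edge of M, guarded by the region g, can fire from (l, \<rho> l) because g
      is a successor of \<rho> l.\<close>
    have "((l, \<rho> l), (g, a), region_dist K X g \<mu>) \<in> pa_trans ?P"
      unfolding region_pa_trans_iff X[symmetric] using e g IH by blast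
    moreover have "(Y, l', \<rho> l') \<in> set_pmf (region_dist K X g \<mu>)"
      using l' \<rho> by (simp add: set_pmf_region_dist)
    ultimately have "(l', \<rho> l') \<in> ?S" using IH(2) pa_reach_step by metis
    then show ?case using \<rho> g Succ_subset_regions reset_region_in_regions by (metis subsetD)
  qed
  have all: "\<rho> l \<in> regions K X \<and> (l, \<rho> l) \<in> ?S" if "l \<in> pta_locs M" for l
    using reach that f by (meson bij_betwE)
  \<comment> \<open>An injection between finite sets of equal size is onto, so no reachable state
    has another region.\<close>
  have "(\<lambda>l. (l, \<rho> l)) ` pta_locs M = ?S"
  proof (rule card_subset_eq)
    show "finite ?S" using f fin bij_betw_finite by blast
    show "(\<lambda>l. (l, \<rho> l)) ` pta_locs M \<subseteq> ?S" using all by blast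
    show "card ((\<lambda>l. (l, \<rho> l)) ` pta_locs M) = card ?S"
      using bij_betw_same_card[OF f] by (simp add: card_image inj_on_def)
  qed
  then have unique: "\<theta> = \<rho> l" if "(l, \<theta>) \<in> ?S" for l \<theta> using that by auto
  show ?thesis
  proof (rule that[of \<rho>], unfold_locales)
    fix l g a \<mu> Y l' assume "(l, g, a, \<mu>) \<in> pta_edges M" "(Y, l') \<in> set_pmf \<mu>"
    then show "\<rho> l' = reset_region K X g Y" using edge by fast
  next
    fix l g a \<mu> assume "(l, g, a, \<mu>) \<in> pta_edges M"
    then show "g \<in> Succ K X (\<rho> l)" using edge by fast
  qed (use X \<rho>0 all unique in auto)
qed


section \<open>Satisfaction\<close>

text \<open>From (l, \<rho> l) an edge of l fires in exactly one region, its guard, so edges and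
  region transitions match one to one up to \<open>region_dist\<close>.\<close>

lemma (in entry_regions) pa_sat_rel_lift:
  assumes "X = apta_clocks A" and R: "pta_sat_rel K M A R"
  shows "pa_sat_rel (region_pa K M) (region_apa K A) {((l, \<rho> l), (l', \<rho> l)) | l l'. (l, l') \<in> R}"
    (is "pa_sat_rel _ _ ?R'")
proof -
  note X = clocks \<open>X = apta_clocks A\<close>
  have locs: "l \<in> pta_locs M" "l' \<in> apta_locs A" if "(l, l') \<in> R" for l l'
    using R that by (auto simp: pta_sat_rel_def)
  note R_rel = bspec[OF conjunct2[OF R[unfolded pta_sat_rel_def]], of "(l, l')" for l l',
    unfolded split_conv]
  have corr: "corresponds (labelled ?R') (region_dist K X g \<mu>) (region_dist K X g \<mu>')"
    if "(l, g, a, \<mu>) \<in> pta_edges M" "corresponds (labelled R) \<mu> \<mu>'" for l g a \<mu> \<mu>'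
    using that(2)
  proof (rule corresponds_region_dist)
    fix Y m m' assume "(Y, m) \<in> set_pmf \<mu>" "(m, m') \<in> R"
    then show "((m, reset_region K X g Y), (m', reset_region K X g Y)) \<in> ?R'"
      using target[OF that(1)] by fastforce
  qed
  have must: "\<exists>\<nu>. ((l, \<rho> l), b, \<nu>) \<in> pa_trans (region_pa K M) \<and>
      (\<exists>\<nu>'\<in>\<psi>. corresponds (labelled ?R') \<nu> \<nu>')"
    if ll': "(l, l') \<in> R" and tr: "apa_trans (region_apa K A) (l', \<rho> l) b \<psi> = Must" for l l' b \<psi>
  proof -
    obtain \<theta> a where b: "b = (\<theta>, a)" by (cases b)
    obtain g' \<phi> where \<theta>: "\<theta> \<in> Succ K X (\<rho> l)" "\<theta> \<subseteq> g'" and e': "apta_edges A l' g' a \<phi> = Must"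
      and \<psi>: "\<psi> = region_dist K X \<theta> ` \<phi>"
      using tr unfolding b region_apa_trans_Must_iff X(2)[symmetric] by blast
    obtain E where E: "E \<subseteq> {(g, \<mu>). (l, g, a, \<mu>) \<in> pta_edges M}"
      "\<forall>\<theta>. (l, \<theta>) \<in> pa_reach (region_pa K M) \<longrightarrow>
        g' \<inter> \<Union> (Succ K X \<theta>) \<subseteq> (\<Union>(g, \<mu>)\<in>E. g)"
      "\<forall>(g, \<mu>)\<in>E. \<exists>\<mu>'\<in>\<phi>. corresponds (labelled R) \<mu> \<mu>'"
      using conjunct1[OF R_rel[OF ll'], rule_format, OF e'] unfolding X(1)[symmetric]
      by (elim exE conjE) (rule that)
    \<comment> \<open>A single valuation v of \<theta> is enough: it is covered by the guard of some
      edge in E, and that guard, a region sharing v with \<theta>, equals \<theta>.\<close>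
    have \<theta>r: "\<theta> \<in> regions K X" using \<theta>(1) Succ_subset_regions by blast
    then obtain v where v: "v \<in> \<theta>" using regions_nonempty by blast
    then obtain g \<mu> where g: "(g, \<mu>) \<in> E" "v \<in> g"
      using E(2)[rule_format, OF reach[OF locs(1)[OF ll']]] \<theta> by blast
    have e: "(l, g, a, \<mu>) \<in> pta_edges M" using E(1) g by blast
    then have "g = \<theta>" using guard Succ_subset_regions \<theta>r v g(2) regions_eqI by (metis subsetD)
    with e have e: "(l, \<theta>, a, \<mu>) \<in> pta_edges M" by simp
    obtain \<mu>' where \<mu>': "\<mu>' \<in> \<phi>" "corresponds (labelled R) \<mu> \<mu>'" using E(3) g by blast
    have "((l, \<rho> l), b, region_dist K X \<theta> \<mu>) \<in> pa_trans (region_pa K M)"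
      unfolding b region_pa_trans_iff X(1)[symmetric]
      using e reg[OF locs(1)[OF ll']] \<theta>(1) by blast
    then show ?thesis using corr[OF e \<mu>'(2)] \<mu>'(1) \<psi> by blast
  qed
  have may: "\<exists>\<psi>. apa_trans (region_apa K A) (l', \<rho> l) b \<psi> \<noteq> Absent \<and>
      (\<exists>\<nu>'\<in>\<psi>. corresponds (labelled ?R') \<nu> \<nu>')"
    if ll': "(l, l') \<in> R" and tr: "((l, \<rho> l), b, \<nu>) \<in> pa_trans (region_pa K M)" for l l' b \<nu>
  proof -
    obtain \<theta> a where b: "b = (\<theta>, a)" by (cases b)
    obtain g \<mu> where e: "(l, g, a, \<mu>) \<in> pta_edges M" and \<theta>: "\<theta> \<in> Succ K X (\<rho> l)" "\<theta> \<subseteq> g"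
      and \<nu>: "\<nu> = region_dist K X \<theta> \<mu>"
      using tr unfolding b region_pa_trans_iff X(1)[symmetric] by blast
    have "\<theta> = g" using guard[OF e] \<theta> Succ_subset_regions regions_subset_eq by (metis subsetD)
    with e have e: "(l, \<theta>, a, \<mu>) \<in> pta_edges M" by simp
    then obtain g' \<phi> \<mu>' where A: "apta_edges A l' g' a \<phi> \<noteq> Absent" "\<theta> \<subseteq> g'"
      "\<mu>' \<in> \<phi>" "corresponds (labelled R) \<mu> \<mu>'"
      using conjunct1[OF conjunct2[OF R_rel[OF ll']]] by blast
    have "apa_trans (region_apa K A) (l', \<rho> l) b (region_dist K X \<theta> ` \<phi>) \<noteq> Absent"
      unfolding b region_apa_trans_not_Absent_iff X(2)[symmetric]
      using A reg[OF locs(1)[OF ll']] \<theta>(1) by blast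
    then show ?thesis using corr[OF e A(4)] A(3) \<nu> by blast
  qed
  have "pta_val M l \<in> apta_val A l'" if "(l, l') \<in> R" for l l'
    using R that by (auto simp: pta_sat_rel_def)
  then have val: "pa_val (region_pa K M) (l, \<theta>) \<in> apa_val (region_apa K A) (l', \<theta>)"
    if "(l, l') \<in> R" for l l' \<theta>
    using that by (simp add: region_pa_def region_apa_def Let_def)
  have states: "?R' \<subseteq> pa_states (region_pa K M) \<times> apa_states (region_apa K A)"
    using locs reg X by (auto simp: region_pa_def region_apa_def Let_def)
  show ?thesis unfolding pa_sat_rel_def
    by (intro conjI ballI, rule states, elim CollectE exE conjE, simp only: split_conv,
        intro conjI allI impI; (rule must may val; assumption))
qed

text \<open>Pairs of R' with differing regions are discarded. This is safe because corresponding
  targets of region transitions always carry a common region, which by \<open>target\<close> is the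
  entry region.\<close>

lemma (in entry_regions) pta_sat_rel_project:
  assumes pta: "is_pta K M" and apta: "is_apta K A" and "X = apta_clocks A"
    and R': "pa_sat_rel (region_pa K M) (region_apa K A) R'"
  shows "pta_sat_rel K M A {(l, l'). ((l, \<rho> l), (l', \<rho> l)) \<in> R'}" (is "pta_sat_rel _ _ _ ?R")
proof -
  note X = clocks \<open>X = apta_clocks A\<close>
  have locs: "l \<in> pta_locs M" "l' \<in> apta_locs A" if "(l, l') \<in> ?R" for l l'
    using R' that by (auto simp: pa_sat_rel_def region_pa_def region_apa_def Let_def)
  note R'_rel = bspec[OF conjunct2[OF R'[unfolded pa_sat_rel_def]],
    of "((l, \<rho> l), (l', \<rho> l))" for l l', unfolded split_conv]
  have corr: "corresponds (labelled ?R) \<mu> \<mu>'"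
    if "(l, g, a, \<mu>) \<in> pta_edges M"
      "corresponds (labelled R') (region_dist K X g \<mu>) (region_dist K X g \<mu>')" for l g a \<mu> \<mu>'
    using that(2)
  proof (rule corresponds_region_distD)
    fix Y m m' assume "(Y, m) \<in> set_pmf \<mu>"
      "((m, reset_region K X g Y), (m', reset_region K X g Y)) \<in> R'"
    then show "(m, m') \<in> ?R" using target[OF that(1)] by simp
  qed
  have must: "\<exists>E. finite E \<and> E \<subseteq> {(g, \<mu>). (l, g, a, \<mu>) \<in> pta_edges M} \<and>
      (\<forall>\<theta>. (l, \<theta>) \<in> pa_reach (region_pa K M) \<longrightarrow>
         g' \<inter> \<Union> (Succ K (pta_clocks M) \<theta>) \<subseteq> (\<Union>(g, \<mu>)\<in>E. g)) \<and>
      (\<forall>(g, \<mu>)\<in>E. \<exists>\<mu>'\<in>\<phi>. corresponds (labelled ?R) \<mu> \<mu>')"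
    if ll': "(l, l') \<in> ?R" and e': "apta_edges A l' g' a \<phi> = Must" for l l' g' a \<phi>
  proof -
    \<comment> \<open>The part of the guard to be covered splits into these regions; each is
      answered separately by an edge with exactly this guard.\<close>
    let ?T = "{\<theta> \<in> Succ K X (\<rho> l). \<theta> \<subseteq> g'}"
    have "\<exists>\<mu>. (l, \<theta>, a, \<mu>) \<in> pta_edges M \<and> (\<exists>\<mu>'\<in>\<phi>. corresponds (labelled ?R) \<mu> \<mu>')"
      if \<theta>: "\<theta> \<in> ?T" for \<theta>
    proof -
      have "apa_trans (region_apa K A) (l', \<rho> l) (\<theta>, a) (region_dist K X \<theta> ` \<phi>) = Must"
        unfolding region_apa_trans_Must_iff X(2)[symmetric]
        using \<theta> e' reg[OF locs(1)[OF ll']] by blast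
      then obtain \<nu> \<mu>' where tr: "((l, \<rho> l), (\<theta>, a), \<nu>) \<in> pa_trans (region_pa K M)"
        and \<mu>': "\<mu>' \<in> \<phi>" "corresponds (labelled R') \<nu> (region_dist K X \<theta> \<mu>')"
        using conjunct1[OF R'_rel[OF ll'[simplified]]] by blast
      obtain g \<mu> where e: "(l, g, a, \<mu>) \<in> pta_edges M" and g: "\<theta> \<subseteq> g"
        and \<nu>: "\<nu> = region_dist K X \<theta> \<mu>"
        using tr unfolding region_pa_trans_iff X(1)[symmetric] by blast
      have "\<theta> = g" using guard[OF e] \<theta> g Succ_subset_regions regions_subset_eq
        by (metis (no_types, lifting) mem_Collect_eq subsetD)
      then show ?thesis using e \<mu>' \<nu> corr by blast
    qed
    then have "\<forall>\<theta>\<in>?T. \<exists>\<mu>. (l, \<theta>, a, \<mu>) \<in> pta_edges M \<and>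
        (\<exists>\<mu>'\<in>\<phi>. corresponds (labelled ?R) \<mu> \<mu>')"
      by (rule ballI)
    \<comment> \<open>One distribution is chosen per region, so E inherits finiteness from the set
      of regions.\<close>
    then obtain m where m: "\<forall>\<theta>\<in>?T. (l, \<theta>, a, m \<theta>) \<in> pta_edges M \<and>
        (\<exists>\<mu>'\<in>\<phi>. corresponds (labelled ?R) (m \<theta>) \<mu>')"
      by (rule bchoice[THEN exE])
    have "finite X" using pta X by (simp add: is_pta_def)
    then have "finite (Succ K X (\<rho> l))"
      by (rule finite_subset[OF Succ_subset_regions finite_regions])
    then have fin: "finite ?T" by simp
    \<comment> \<open>Uniqueness of the entry region places v in a successor of \<rho> l; as that
      region meets g', it lies inside g' and belongs to \<open>?T\<close>.\<close>
    have cover: "v \<in> (\<Union>(g, \<mu>)\<in>(\<lambda>\<theta>. (\<theta>, m \<theta>)) ` ?T. g)"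
      if v: "v \<in> g'" "v \<in> \<Union> (Succ K X \<theta>)" and \<theta>: "(l, \<theta>) \<in> pa_reach (region_pa K M)" for v \<theta>
    proof -
      obtain \<theta>'' where \<theta>'': "\<theta>'' \<in> Succ K X (\<rho> l)" "v \<in> \<theta>''" using v(2) unique[OF \<theta>] by blast
      have "g' \<in> CC K X" using apta e' X unfolding is_apta_def by (metis modality.distinct(3))
      then have "\<theta>'' \<subseteq> g'"
        using region_subset_guard \<theta>'' v(1) Succ_subset_regions by (metis subsetD)
      then show ?thesis using \<theta>'' by blast
    qed
    show ?thesis
    proof (intro exI[of _ "(\<lambda>\<theta>. (\<theta>, m \<theta>)) ` ?T"] conjI allI impI)
      show "finite ((\<lambda>\<theta>. (\<theta>, m \<theta>)) ` ?T)" using fin by (rule finite_imageI)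
      show "(\<lambda>\<theta>. (\<theta>, m \<theta>)) ` ?T \<subseteq> {(g, \<mu>). (l, g, a, \<mu>) \<in> pta_edges M}" using m by blast
      show "g' \<inter> \<Union> (Succ K (pta_clocks M) \<theta>) \<subseteq> (\<Union>(g, \<mu>)\<in>(\<lambda>\<theta>. (\<theta>, m \<theta>)) ` ?T. g)"
        if "(l, \<theta>) \<in> pa_reach (region_pa K M)" for \<theta>
        unfolding X(1)[symmetric] using cover that by (intro subsetI) (elim IntE)
      show "\<forall>(g, \<mu>)\<in>(\<lambda>\<theta>. (\<theta>, m \<theta>)) ` ?T. \<exists>\<mu>'\<in>\<phi>. corresponds (labelled ?R) \<mu> \<mu>'"
        using m by simp
    qed
  qed
  have may: "\<exists>g' \<phi>. apta_edges A l' g' a \<phi> \<noteq> Absent \<and> g \<subseteq> g' \<and>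
      (\<exists>\<mu>'\<in>\<phi>. corresponds (labelled ?R) \<mu> \<mu>')"
    if ll': "(l, l') \<in> ?R" and e: "(l, g, a, \<mu>) \<in> pta_edges M" for l l' g a \<mu>
  proof -
    \<comment> \<open>Firing the edge in all of its guard g makes the answering edge of A have a
      guard that contains g.\<close>
    have "((l, \<rho> l), (g, a), region_dist K X g \<mu>) \<in> pa_trans (region_pa K M)"
      unfolding region_pa_trans_iff X(1)[symmetric]
      using e guard[OF e] reg[OF locs(1)[OF ll']] by blast
    then obtain \<psi> \<nu>' where "apa_trans (region_apa K A) (l', \<rho> l) (g, a) \<psi> \<noteq> Absent"
      "\<nu>' \<in> \<psi>" "corresponds (labelled R') (region_dist K X g \<mu>) \<nu>'"
      using conjunct1[OF conjunct2[OF R'_rel[OF ll'[simplified]]]] by blast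
    then show ?thesis unfolding region_apa_trans_not_Absent_iff X(2)[symmetric]
      using corr[OF e] by blast
  qed
  have "pa_val (region_pa K M) (l, \<rho> l) \<in> apa_val (region_apa K A) (l', \<rho> l)"
    if "(l, l') \<in> ?R" for l l'
    using R' that by (auto simp: pa_sat_rel_def)
  then have val: "pta_val M l \<in> apta_val A l'" if "(l, l') \<in> ?R" for l l'
    using that by (simp add: region_pa_def region_apa_def Let_def)
  have states: "?R \<subseteq> pta_locs M \<times> apta_locs A" using locs by auto
  show ?thesis unfolding pta_sat_rel_def
    by (intro conjI ballI, rule states, rename_tac p, case_tac p, simp only: split_conv,
        intro conjI allI impI; (rule must may val; assumption))
qed

theorem theorem1:
  fixes K :: nat
    and M :: "('l, 'a, 'x, 'p) pta"
    and A :: "('m, 'a, 'x, 'p) apta"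
  assumes "is_pta K M"
    and "is_apta K A"
    and "pta_acts M = apta_acts A"
    and "pta_clocks M = apta_clocks A"
    and "pta_props M = apta_props A"
    and "normal_form K M"
  shows "pta_sat K M A \<longleftrightarrow> pa_sat (region_pa K M) (region_apa K A)"
proof -
  obtain \<rho> where \<rho>: "entry_regions K M (pta_clocks M) \<rho>"
    using normal_form_entry_regions[OF assms(1,6) refl] by blast
  interpret entry_regions K M "pta_clocks M" \<rho> by (rule \<rho>)
  \<comment> \<open>Both initial states carry the zero region since the clock sets agree, so the
    initial pair has the shape used in both directions.\<close>
  have inits: "pa_init (region_pa K M) = (pta_init M, \<rho> (pta_init M))"
    "apa_init (region_apa K A) = (apta_init A, \<rho> (pta_init M))"
    unfolding init by (simp_all add: region_pa_def region_apa_def Let_def assms(4))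
  show ?thesis
  proof
    assume "pta_sat K M A"
    then obtain R where "pta_sat_rel K M A R" "(pta_init M, apta_init A) \<in> R"
      by (auto simp: pta_sat_def)
    then show "pa_sat (region_pa K M) (region_apa K A)"
      using pa_sat_rel_lift[OF assms(4)] unfolding pa_sat_def inits by blast
  next
    assume "pa_sat (region_pa K M) (region_apa K A)"
    then obtain R' where "pa_sat_rel (region_pa K M) (region_apa K A) R'"
      "((pta_init M, \<rho> (pta_init M)), (apta_init A, \<rho> (pta_init M))) \<in> R'"
      by (auto simp: pa_sat_def inits)
    then show "pta_sat K M A"
      using pta_sat_rel_project[OF assms(1,2,4)] unfolding pta_sat_def by blast
  qed
qed

end
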